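(* Let $n\ge1$ be a given degree and $\omega>0$. There exists a unitary best approximation $r\in\mathcal{U}_n$, i.e., $$\| r - \exp(\omega \cdot)\| = \inf_{u \in\mathcal{U}_n} \| u - \exp(\omega \cdot)\|.$$
   Context: For a complex polynomial $p$ let $p^\dag(z):=\overline{p}(-z)=\overline{p(-\overline z)}$, where $\overline p$ has complex-conjugated coefficients. Let $\mathcal{U}_n:=\{p^\dag/p : p \text{ a complex polynomial of degree}\le n,\ p\not\equiv 0\}$. Rational functions are identified with their irreducible form (removable singularities are removed), so that every $r\in\mathcal{U}_n$ has no poles on $\mathrm{i}\mathbb{R}$ and $|r(\mathrm{i}x)|=1$ for $x\in\mathbb{R}$. For $r\in\mathcal{U}_n$, $\|r-\exp(\omega\cdot)\|:=\max_{x\in[-1,1]}|r(\mathrm{i}x)-\mathrm{e}^{\mathrm{i}\omega x}|$. *)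

theory Defs
  imports
    "HOL-Analysis.Analysis"
    "HOL-Computational_Algebra.Computational_Algebra"
    "HOL-Computational_Algebra.Field_as_Ring"
begin

definition dagger :: "complex poly \<Rightarrow> complex poly" where
  "dagger p = pcompose (map_poly cnj p) [:0, - 1:]"

definition unitary_rat :: "nat \<Rightarrow> complex poly fract set" where
  "unitary_rat n = {Fract (dagger p) p | p. degree p \<le> n \<and> p \<noteq> 0}"

text \<open>
  Evaluation goes through the coprime representation, so removable singularities are removed;
  at a genuine pole the value is the junk value \<open>0\<close>.
\<close>
definition rat_eval :: "complex poly fract \<Rightarrow> complex \<Rightarrow> complex" where
  "rat_eval r z = poly (fst (quot_of_fract r)) z / poly (snd (quot_of_fract r)) z"

text \<open>
  Rendered as a supremum; for \<open>r \<in> unitary_rat n\<close> it is attained, see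
  \<open>exp_error_is_max\<close> below.
\<close>
definition exp_error :: "real \<Rightarrow> complex poly fract \<Rightarrow> real" where
  "exp_error \<omega> r =
     (SUP x\<in>{-1..1}. cmod (rat_eval r (\<i> * complex_of_real x) - exp (\<i> * complex_of_real (\<omega> * x))))"

lemma poly_dagger: "poly (dagger p) z = cnj (poly p (- cnj z))"
  by (simp add: dagger_def poly_pcompose)

lemma poly_dagger_imag_axis:
  "poly (dagger p) (\<i> * complex_of_real x) = cnj (poly p (\<i> * complex_of_real x))"
  by (simp add: poly_dagger)

lemma quot_of_unitary:
  assumes "r \<in> unitary_rat n"
  obtains p where "p \<noteq> 0"
    "fst (quot_of_fract r) * p = snd (quot_of_fract r) * dagger p"
proof -
  obtain p where p: "r = Fract (dagger p) p" "p \<noteq> 0"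
    using assms by (auto simp: unitary_rat_def)
  have "Fract (fst (quot_of_fract r)) (snd (quot_of_fract r)) = Fract (dagger p) p"
    using p Fract_quot_of_fract[of r] by simp
  then have "fst (quot_of_fract r) * p = dagger p * snd (quot_of_fract r)"
    using p(2) by (subst (asm) eq_fract(1)) simp_all
  with p(2) that show thesis by (simp add: mult.commute)
qed

lemma quot_norm_eq_imag_axis:
  assumes "r \<in> unitary_rat n"
  shows "cmod (poly (fst (quot_of_fract r)) (\<i> * complex_of_real x))
       = cmod (poly (snd (quot_of_fract r)) (\<i> * complex_of_real x))"
proof -
  define a b where "a = fst (quot_of_fract r)" and "b = snd (quot_of_fract r)"
  obtain p where p: "p \<noteq> 0" "a * p = b * dagger p"
    using quot_of_unitary[OF assms] unfolding a_def b_def by blast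
  define f where
    "f = (\<lambda>x::real. cmod (poly a (\<i> * complex_of_real x)) - cmod (poly b (\<i> * complex_of_real x)))"
  define S where "S = {x::real. poly p (\<i> * complex_of_real x) = 0}"
  have zero: "f x = 0" if "x \<notin> S" for x
  proof -
    have "poly (a * p) (\<i> * complex_of_real x) = poly (b * dagger p) (\<i> * complex_of_real x)"
      using p by simp
    then have "cmod (poly a (\<i> * complex_of_real x)) * cmod (poly p (\<i> * complex_of_real x)) =
      cmod (poly b (\<i> * complex_of_real x)) * cmod (poly p (\<i> * complex_of_real x))"
      by (metis complex_mod_cnj norm_mult poly_dagger_imag_axis poly_mult)
    with that show ?thesis by (simp add: S_def f_def)
  qed
  have "finite S"
  proof -
    have "inj_on (\<lambda>x. \<i> * complex_of_real x) S" by (auto simp: inj_on_def)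
    moreover have "finite ((\<lambda>x. \<i> * complex_of_real x) ` S)"
      by (rule finite_subset[OF _ poly_roots_finite[OF p(1)]]) (auto simp: S_def)
    ultimately show ?thesis using finite_imageD by blast
  qed
  then have "eventually (\<lambda>y. y \<notin> S) (at x)"
    using islimpt_finite[of S x] islimpt_iff_eventually[of x S] by blast
  then have "eventually (\<lambda>y. f y = 0) (at x)"
    by eventually_elim (rule zero)
  then have "(f \<longlongrightarrow> 0) (at x)" by (rule tendsto_eventually)
  moreover have "(f \<longlongrightarrow> f x) (at x)"
    unfolding f_def by (intro tendsto_intros)
  ultimately have "f x = 0" using tendsto_unique trivial_limit_at by blast
  then show ?thesis by (simp add: f_def a_def b_def)
qed

lemma quot_no_pole_imag_axis:
  assumes "r \<in> unitary_rat n"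
  shows "poly (snd (quot_of_fract r)) (\<i> * complex_of_real x) \<noteq> 0"
proof
  assume b: "poly (snd (quot_of_fract r)) (\<i> * complex_of_real x) = 0"
  with quot_norm_eq_imag_axis[OF assms, of x]
  have "poly (fst (quot_of_fract r)) (\<i> * complex_of_real x) = 0" by simp
  with b have "[:- (\<i> * complex_of_real x), 1:] dvd 1"
    using coprime_quot_of_fract[of r] coprime_common_divisor
    unfolding poly_eq_0_iff_dvd by blast
  then show False by (simp add: is_unit_iff_degree)
qed

lemma norm_rat_eval_imag_axis:
  assumes "r \<in> unitary_rat n"
  shows "cmod (rat_eval r (\<i> * complex_of_real x)) = 1"
  using quot_no_pole_imag_axis[OF assms] quot_norm_eq_imag_axis[OF assms]
  by (simp add: rat_eval_def norm_divide)

lemma exp_error_is_max: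
  assumes "r \<in> unitary_rat n"
  obtains x where "x \<in> {-1..1}"
    "exp_error \<omega> r = cmod (rat_eval r (\<i> * complex_of_real x) - exp (\<i> * complex_of_real (\<omega> * x)))"
    "\<And>y. y \<in> {-1..1} \<Longrightarrow>
       cmod (rat_eval r (\<i> * complex_of_real y) - exp (\<i> * complex_of_real (\<omega> * y))) \<le> exp_error \<omega> r"
proof -
  define f where
    "f = (\<lambda>x. cmod (rat_eval r (\<i> * complex_of_real x) - exp (\<i> * complex_of_real (\<omega> * x))))"
  have "continuous_on {-1..1} f"
    unfolding f_def rat_eval_def using quot_no_pole_imag_axis[OF assms]
    by (intro continuous_intros) auto
  then obtain x where x: "x \<in> {-1..1}" "\<And>y. y \<in> {-1..1} \<Longrightarrow> f y \<le> f x"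
    using continuous_attains_sup[of "{-1..1::real}" f] by auto
  then have "exp_error \<omega> r = f x"
    unfolding exp_error_def f_def[symmetric] by (intro cSup_eq_maximum) (auto simp: f_def)
  with x that show thesis by (simp add: f_def)
qed

end

theory Submission
  imports Defs
begin

text \<open>
  Existence is a compactness argument. A unitary function \<open>p\<^sup>\<dagger>/p\<close> does not change when \<open>p\<close> is
  multiplied by a positive real, so \<open>p\<close> may be taken on the unit sphere of the coefficient norm
  \<open>\<Sum>i\<le>n. cmod (coeff p i)\<close> (lemma \<open>unitary_rat_normalized\<close>). Along a minimizing sequence some
  subsequence of these denominators therefore converges coefficientwise to a polynomial \<open>p\<close>, and
  \<open>p\<close> is again on the sphere, hence nonzero: it defines a candidate \<open>r = p\<^sup>\<dagger>/p\<close>.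

  The difficulty is that \<open>p\<close> may vanish at points of the imaginary axis although \<open>r\<close>, in lowest
  terms, has no pole there; near such points the convergence of the functions need not be uniform, and
  the limit may have smaller degree. This does no harm, because only an upper bound for the error
  of \<open>r\<close> is wanted. Away from the finitely many zeros of \<open>p\<close> the functions converge pointwise, so
  the pointwise error of \<open>r\<close> is at most the infimum there; as \<open>r\<close> is continuous on the imaginary
  axis, the bound extends to the exceptional points.
\<close>

text \<open>
  A zero of the reduced denominator at \<open>z\<close> would force one of the reduced numerator when
  \<open>poly b z \<noteq> 0\<close>, against coprimality; so cross-multiplication can be divided out at \<open>z\<close>.
\<close>
lemma rat_eval_Fract:
  assumes "poly b z \<noteq> 0"
  shows "rat_eval (Fract a b) z = poly a z / poly b z"
proof -
  define c d where "c = fst (quot_of_fract (Fract a b))" and "d = snd (quot_of_fract (Fract a b))"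
  have "b \<noteq> 0" using assms by auto
  have "d \<noteq> 0" unfolding d_def by simp
  have "Fract c d = Fract a b" unfolding c_def d_def by simp
  then have "c * b = a * d"
    using \<open>b \<noteq> 0\<close> \<open>d \<noteq> 0\<close> by (simp add: eq_fract)
  then have cross: "poly c z * poly b z = poly a z * poly d z"
    by (metis poly_mult)
  have "poly d z \<noteq> 0"
  proof
    assume d0: "poly d z = 0"
    with cross assms have "poly c z = 0" by simp
    with d0 have "[:- z, 1:] dvd 1"
      using coprime_quot_of_fract[of "Fract a b"] coprime_common_divisor
      unfolding poly_eq_0_iff_dvd c_def d_def by blast
    then show False by (simp add: is_unit_iff_degree)
  qed
  with cross assms show ?thesis
    unfolding rat_eval_def c_def[symmetric] d_def[symmetric] by (simp add: frac_eq_eq)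
qed

lemma rat_eval_unitary_imag_axis:
  assumes "poly p (\<i> * complex_of_real x) \<noteq> 0"
  shows "rat_eval (Fract (dagger p) p) (\<i> * complex_of_real x)
       = cnj (poly p (\<i> * complex_of_real x)) / poly p (\<i> * complex_of_real x)"
  using rat_eval_Fract[OF assms] by (simp only: poly_dagger_imag_axis)

text \<open>
  The scaling factor has to be real: a complex factor \<open>c\<close> multiplies the quotient by
  \<open>cnj c / c\<close>.
\<close>
lemma Fract_dagger_smult_of_real:
  assumes "c \<noteq> 0" and "p \<noteq> 0"
  shows "Fract (dagger (smult (of_real c) p)) (smult (of_real c) p) = Fract (dagger p) p"
proof -
  have "dagger (smult (of_real c) p) = smult (of_real c) (dagger p)"
    unfolding poly_eq_poly_eq_iff[symmetric] by (rule ext) (simp add: poly_dagger)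
  then show ?thesis using assms by (simp add: eq_fract)
qed

lemma unitary_rat_normalized:
  assumes "u \<in> unitary_rat n"
  obtains p where "u = Fract (dagger p) p" "degree p \<le> n" "(\<Sum>i\<le>n. cmod (coeff p i)) = 1"
proof -
  obtain q where q: "u = Fract (dagger q) q" "degree q \<le> n" "q \<noteq> 0"
    using assms by (auto simp: unitary_rat_def)
  define s where "s = (\<Sum>i\<le>n. cmod (coeff q i))"
  have "cmod (lead_coeff q) \<le> s"
    unfolding s_def by (rule member_le_sum) (use q in auto)
  moreover have "cmod (lead_coeff q) > 0" using q by simp
  ultimately have "s > 0" by linarith
  define p where "p = smult (of_real (1 / s)) q"
  have "u = Fract (dagger p) p"
    unfolding p_def using q \<open>s > 0\<close> by (subst Fract_dagger_smult_of_real) auto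
  moreover have "degree p \<le> n"
    unfolding p_def using q degree_smult_le order_trans by blast
  moreover have "(\<Sum>i\<le>n. cmod (coeff p i)) = (\<Sum>i\<le>n. (1 / s) * cmod (coeff q i))"
    unfolding p_def using \<open>s > 0\<close> by (intro sum.cong refl) (simp add: norm_mult norm_divide)
  then have "(\<Sum>i\<le>n. cmod (coeff p i)) = 1"
    unfolding sum_distrib_left[symmetric] s_def[symmetric] using \<open>s > 0\<close> by simp
  ultimately show thesis by (rule that)
qed

lemma bounded_family_convergent_subseq:
  fixes a :: "nat \<Rightarrow> 'i \<Rightarrow> 'a::heine_borel"
  assumes "finite I" and "\<And>i. i \<in> I \<Longrightarrow> bounded (range (\<lambda>k. a k i))"
  shows "\<exists>\<sigma> l. strict_mono (\<sigma> :: nat \<Rightarrow> nat) \<and> (\<forall>i\<in>I. (\<lambda>k. a (\<sigma> k) i) \<longlonglongrightarrow> l i)"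
  using assms
proof (induction I rule: finite_induct)
  case empty
  have "strict_mono (\<lambda>k::nat. k)" by (simp add: strict_mono_def)
  then show ?case by blast
next
  case (insert j I)
  then obtain \<sigma> :: "nat \<Rightarrow> nat" and l
    where \<sigma>: "strict_mono \<sigma>" "\<And>i. i \<in> I \<Longrightarrow> (\<lambda>k. a (\<sigma> k) i) \<longlonglongrightarrow> l i"
    by auto
  have "bounded (range (\<lambda>k. a (\<sigma> k) j))"
    by (rule bounded_subset[OF insert.prems[of j]]) auto
  then obtain m and \<tau> :: "nat \<Rightarrow> nat"
    where \<tau>: "strict_mono \<tau>" "((\<lambda>k. a (\<sigma> k) j) \<circ> \<tau>) \<longlonglongrightarrow> m"
    using bounded_imp_convergent_subsequence by blast
  have "(\<lambda>k. a ((\<sigma> \<circ> \<tau>) k) i) \<longlonglongrightarrow> (l(j := m)) i" if "i \<in> insert j I" for i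
  proof (cases "i = j")
    case True
    with \<tau> show ?thesis by (simp add: comp_def)
  next
    case False
    with that have "i \<in> I" by simp
    with False LIMSEQ_subseq_LIMSEQ[OF \<sigma>(2) \<tau>(1)] show ?thesis by (simp add: comp_def)
  qed
  moreover have "strict_mono (\<sigma> \<circ> \<tau>)" using \<sigma> \<tau> by (intro strict_mono_o)
  ultimately show ?case by blast
qed

text \<open>
  Compactness of the unit sphere in the space of polynomials of degree at most \<open>n\<close>. That the
  limit stays on the sphere is what keeps the denominator from degenerating to \<open>0\<close>.
\<close>
lemma normalized_polys_convergent_subseq:
  fixes P :: "nat \<Rightarrow> complex poly"
  assumes "\<And>k. degree (P k) \<le> n" and "\<And>k. (\<Sum>i\<le>n. cmod (coeff (P k) i)) = 1"
  obtains \<sigma> p where "strict_mono (\<sigma> :: nat \<Rightarrow> nat)" "degree p \<le> n" "p \<noteq> 0"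
    "\<forall>z. (\<lambda>k. poly (P (\<sigma> k)) z) \<longlonglongrightarrow> poly p z"
proof -
  have "cmod (coeff (P k) i) \<le> 1" if "i \<le> n" for k i
    unfolding assms(2)[of k, symmetric] by (rule member_le_sum) (use that in auto)
  then have "bounded (range (\<lambda>k. coeff (P k) i))" if "i \<in> {..n}" for i
    using that unfolding bounded_iff by auto
  then obtain \<sigma> l where \<sigma>: "strict_mono (\<sigma> :: nat \<Rightarrow> nat)"
    and l: "\<And>i. i \<le> n \<Longrightarrow> (\<lambda>k. coeff (P (\<sigma> k)) i) \<longlonglongrightarrow> l i"
    using bounded_family_convergent_subseq[of "{..n}" "\<lambda>k. coeff (P k)"] by auto
  define p where "p = (\<Sum>i\<le>n. monom (l i) i)"
  have deg: "degree p \<le> n"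
    unfolding p_def by (intro degree_sum_le) (auto intro: order_trans[OF degree_monom_le])
  have "(\<lambda>k. \<Sum>i\<le>n. cmod (coeff (P (\<sigma> k)) i)) \<longlonglongrightarrow> (\<Sum>i\<le>n. cmod (l i))"
    by (intro tendsto_sum tendsto_norm l) simp
  then have "(\<Sum>i\<le>n. cmod (l i)) = 1"
    unfolding assms(2) by (simp add: LIMSEQ_const_iff)
  moreover have "coeff p i = l i" if "i \<le> n" for i
    unfolding p_def using that by (simp add: coeff_sum)
  ultimately have "p \<noteq> 0" by auto
  have "(\<lambda>k. poly (P (\<sigma> k)) z) \<longlonglongrightarrow> poly p z" for z
  proof -
    have "(\<lambda>k. \<Sum>i\<le>n. coeff (P (\<sigma> k)) i * z ^ i) \<longlonglongrightarrow> (\<Sum>i\<le>n. l i * z ^ i)"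
      by (intro tendsto_sum tendsto_mult_right l) simp
    moreover have "poly (P k) z = (\<Sum>i\<le>n. coeff (P k) i * z ^ i)" for k
      unfolding poly_altdef
      by (rule sum.mono_neutral_left) (use assms(1)[of k] in \<open>auto simp: coeff_eq_0\<close>)
    moreover have "poly p z = (\<Sum>i\<le>n. l i * z ^ i)"
      unfolding p_def by (simp add: poly_sum poly_monom)
    ultimately show ?thesis by simp
  qed
  with \<sigma> deg \<open>p \<noteq> 0\<close> show thesis by (intro that allI)
qed

text \<open>
  The reduced form of \<open>r\<close> is continuous on the whole imaginary axis, so its error may be estimated
  off any finite set, in particular off the zeros of an unreduced denominator.
\<close>
lemma exp_error_le_off_finite:
  assumes r: "r \<in> unitary_rat n" and "finite S"
    and le: "\<And>x. x \<in> {-1..1} - S \<Longrightarrow>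
      cmod (rat_eval r (\<i> * complex_of_real x) - exp (\<i> * complex_of_real (\<omega> * x))) \<le> c"
  shows "exp_error \<omega> r \<le> c"
proof -
  define f where
    "f = (\<lambda>x. cmod (rat_eval r (\<i> * complex_of_real x) - exp (\<i> * complex_of_real (\<omega> * x))))"
  obtain x where x: "x \<in> {-1..1}" "exp_error \<omega> r = f x"
    using exp_error_is_max[OF r, of \<omega>] unfolding f_def by blast
  have "continuous_on {-1..1} f"
    unfolding f_def rat_eval_def using quot_no_pole_imag_axis[OF r]
    by (intro continuous_intros) auto
  with x have lim: "(f \<longlongrightarrow> f x) (at x within {-1..1})"
    by (simp add: continuous_on_def)
  have "eventually (\<lambda>y. y \<notin> S) (at x)"
    using islimpt_finite[OF \<open>finite S\<close>, of x] islimpt_iff_eventually[of x S] by blast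
  then have "eventually (\<lambda>y. y \<notin> S) (at x within {-1..1})"
    using at_le[of "{-1..1}" UNIV x] by (simp add: le_filter_def)
  moreover have "eventually (\<lambda>y. y \<in> {-1..1}) (at x within {-1..1})"
    by (simp add: eventually_at_filter)
  ultimately have "eventually (\<lambda>y. f y \<le> c) (at x within {-1..1})"
    by eventually_elim (use le in \<open>auto simp: f_def\<close>)
  moreover have "at x within {-1..1} \<noteq> bot"
    using x connected_imp_perfect[of "{-1..1::real}" x]
    by (simp add: trivial_limit_within)
  ultimately have "f x \<le> c" by (rule tendsto_upperbound[OF lim])
  with x show ?thesis by simp
qed

theorem proposition3p2:
  fixes n :: nat and \<omega> :: real
  assumes "n \<ge> 1" and "\<omega> > 0"
  shows "\<exists>r\<in>unitary_rat n. exp_error \<omega> r = (INF u\<in>unitary_rat n. exp_error \<omega> u)"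
proof -
  define m where "m = (INF u\<in>unitary_rat n. exp_error \<omega> u)"
  have nonempty: "unitary_rat n \<noteq> {}"
    unfolding unitary_rat_def by (auto intro!: exI[of _ 1])
  have "0 \<le> exp_error \<omega> u" if "u \<in> unitary_rat n" for u
    by (rule exp_error_is_max[OF that, of \<omega>]) simp
  then have bdd: "bdd_below (exp_error \<omega> ` unitary_rat n)"
    by (auto intro!: bdd_belowI[of _ 0])
  have "\<exists>p. degree p \<le> n \<and> (\<Sum>i\<le>n. cmod (coeff p i)) = 1 \<and>
      Fract (dagger p) p \<in> unitary_rat n \<and> exp_error \<omega> (Fract (dagger p) p) < m + 1 / Suc k" for k
  proof -
    have "m < m + 1 / Suc k" by simp
    then obtain u where "u \<in> unitary_rat n" "exp_error \<omega> u < m + 1 / Suc k"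
      unfolding m_def cINF_less_iff[OF nonempty bdd] by blast
    moreover from this(1) obtain p where "u = Fract (dagger p) p" "degree p \<le> n"
      "(\<Sum>i\<le>n. cmod (coeff p i)) = 1"
      by (rule unitary_rat_normalized)
    ultimately show ?thesis by blast
  qed
  then have "\<exists>P. \<forall>k. degree (P k) \<le> n \<and> (\<Sum>i\<le>n. cmod (coeff (P k) i)) = 1 \<and>
      Fract (dagger (P k)) (P k) \<in> unitary_rat n \<and>
      exp_error \<omega> (Fract (dagger (P k)) (P k)) < m + 1 / Suc k"
    by (intro choice allI)
  then obtain P where "\<forall>k. degree (P k) \<le> n \<and> (\<Sum>i\<le>n. cmod (coeff (P k) i)) = 1 \<and>
      Fract (dagger (P k)) (P k) \<in> unitary_rat n \<and>
      exp_error \<omega> (Fract (dagger (P k)) (P k)) < m + 1 / Suc k"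
    by (rule exE)
  then have P: "\<And>k. degree (P k) \<le> n" "\<And>k. (\<Sum>i\<le>n. cmod (coeff (P k) i)) = 1"
    "\<And>k. Fract (dagger (P k)) (P k) \<in> unitary_rat n"
    "\<And>k. exp_error \<omega> (Fract (dagger (P k)) (P k)) < m + 1 / Suc k"
    by simp_all
  obtain \<sigma> p where \<sigma>: "strict_mono (\<sigma> :: nat \<Rightarrow> nat)" and p: "degree p \<le> n" "p \<noteq> 0"
    and lim: "\<forall>z. (\<lambda>k. poly (P (\<sigma> k)) z) \<longlonglongrightarrow> poly p z"
    by (rule normalized_polys_convergent_subseq[of P n, OF P(1,2)])
  define r where "r = Fract (dagger p) p"
  have r: "r \<in> unitary_rat n" using p unfolding r_def unitary_rat_def by blast
  define S where "S = {x::real. poly p (\<i> * complex_of_real x) = 0}"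
  have "finite ((\<lambda>x. \<i> * complex_of_real x) ` S)"
    by (rule finite_subset[OF _ poly_roots_finite[OF p(2)]]) (auto simp: S_def)
  then have "finite S"
    by (rule finite_imageD) (auto simp: inj_on_def)
  have "exp_error \<omega> r \<le> m"
  proof (rule exp_error_le_off_finite[OF r \<open>finite S\<close>])
    fix x :: real assume x: "x \<in> {-1..1} - S"
    define z where "z = \<i> * complex_of_real x"
    define e where "e = exp (\<i> * complex_of_real (\<omega> * x))"
    define u where "u k = Fract (dagger (P (\<sigma> k))) (P (\<sigma> k))" for k
    have pz: "poly p z \<noteq> 0" using x by (simp add: S_def z_def)
    have "(\<lambda>k. cnj (poly (P (\<sigma> k)) z) / poly (P (\<sigma> k)) z) \<longlonglongrightarrow> cnj (poly p z) / poly p z"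
      by (intro tendsto_intros lim[rule_format] pz)
    moreover have "eventually (\<lambda>k. cnj (poly (P (\<sigma> k)) z) / poly (P (\<sigma> k)) z = rat_eval (u k) z)
        sequentially"
      using tendsto_imp_eventually_ne[OF lim[rule_format] pz]
      by eventually_elim (simp add: u_def z_def rat_eval_unitary_imag_axis)
    ultimately have "(\<lambda>k. rat_eval (u k) z) \<longlonglongrightarrow> cnj (poly p z) / poly p z"
      by (rule Lim_transform_eventually)
    then have "(\<lambda>k. rat_eval (u k) z) \<longlonglongrightarrow> rat_eval r z"
      using pz by (simp add: r_def z_def rat_eval_unitary_imag_axis)
    then have "(\<lambda>k. cmod (rat_eval (u k) z - e)) \<longlonglongrightarrow> cmod (rat_eval r z - e)"
      by (intro tendsto_intros)
    moreover have "(\<lambda>k. m + 1 / Suc (\<sigma> k)) \<longlonglongrightarrow> m + 0"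
      using LIMSEQ_subseq_LIMSEQ[OF LIMSEQ_Suc[OF lim_1_over_n] \<sigma>]
      by (intro tendsto_intros) (simp add: comp_def)
    moreover have "cmod (rat_eval (u k) z - e) \<le> m + 1 / Suc (\<sigma> k)" for k
    proof -
      have "cmod (rat_eval (u k) z - e) \<le> exp_error \<omega> (u k)"
        using exp_error_is_max[OF P(3)[of "\<sigma> k"], of \<omega>] x
        unfolding u_def z_def e_def by blast
      also have "\<dots> \<le> m + 1 / Suc (\<sigma> k)"
        using P(4)[of "\<sigma> k"] unfolding u_def by simp
      finally show ?thesis .
    qed
    ultimately have "cmod (rat_eval r z - e) \<le> m + 0"
      by (intro LIMSEQ_le) auto
    then show "cmod (rat_eval r (\<i> * complex_of_real x) - exp (\<i> * complex_of_real (\<omega> * x))) \<le> m"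
      by (simp add: z_def e_def)
  qed
  moreover have "m \<le> exp_error \<omega> r"
    unfolding m_def using bdd r by (rule cINF_lower)
  ultimately show ?thesis using r unfolding m_def by (intro bexI[of _ r]) auto
qed

end
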